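(* Let $f:[0,\infty[\to\mathbb{R}^d$ be a càdlàg function. Then $f$ is Hunt-expandable if and only if $f$ is Markov-expandable and continuous.
   Context: A deterministic (time homogeneous, universal) Markov process on $\mathbb{R}^d$ is a family $(X^x)_{x\in\mathbb{R}^d}$ of functions (paths) $t\mapsto X_t^x$, $[0,\infty[\to\mathbb{R}^d$, not depending on $\omega$, with $X_0^x=x$ for every $x$, such that: whenever $X_s^x=X_t^y$ for some $s,t\ge 0$ and $x,y\in\mathbb{R}^d$, then $X_{s+h}^x=X_{t+h}^y$ for every $h\ge 0$. All paths are assumed to be càdlàg (right-continuous with left limits). A deterministic Markov process is a deterministic Hunt process if in addition it is quasi-left continuous for every starting point, which for deterministic processes is equivalent to left continuity of all paths $t\mapsto X_t^x$. $f$ is Markov-expandable (respectively Hunt-expandable) if there exists a deterministic Markov (respectively Hunt) process $(X^x)_{x\in\mathbb{R}^d}$ with $X_t^{f(0)}=f(t)$ for every $t\ge0$. *)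

theory Defs
  imports "HOL-Probability.Probability"
begin

text \<open>
  Paths on $[0,\infty[$ are represented by functions on all of \<^typ>\<open>real\<close>; their values at
  negative arguments are irrelevant and never constrained.
\<close>

definition cadlag :: "(real \<Rightarrow> 'a::topological_space) \<Rightarrow> bool" where
  "cadlag f \<longleftrightarrow>
     (\<forall>t\<ge>0. (f \<longlongrightarrow> f t) (at_right t)) \<and>
     (\<forall>t>0. \<exists>l. (f \<longlongrightarrow> l) (at_left t))"

text \<open>
  The filtration is indexed by $[0,\infty]$, so that stopping times may take the value $\infty$.
\<close>

locale filtered_prob_space = prob_space M + filtration "space M" F
  for M :: "'w measure" and F :: "ennreal \<Rightarrow> 'w measure" +
  assumes sets_F_subset: "sets (F t) \<subseteq> sets M"

definition quasi_left_continuous ::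
  "'w measure \<Rightarrow> (ennreal \<Rightarrow> 'w measure) \<Rightarrow> (real \<Rightarrow> 'w \<Rightarrow> 'a::topological_space) \<Rightarrow> bool" where
  "quasi_left_continuous M F Y \<longleftrightarrow>
     (\<forall>T :: nat \<Rightarrow> 'w \<Rightarrow> ennreal.
        (\<forall>n. stopping_time F (T n)) \<longrightarrow>
        (\<forall>\<omega>\<in>space M. incseq (\<lambda>n. T n \<omega>)) \<longrightarrow>
        (AE \<omega> in M. (SUP n. T n \<omega>) < \<infinity> \<longrightarrow>
           (\<lambda>n. Y (enn2real (T n \<omega>)) \<omega>) \<longlonglongrightarrow> Y (enn2real (SUP n. T n \<omega>)) \<omega>))"

definition deterministic_markov :: "('a::topological_space \<Rightarrow> real \<Rightarrow> 'a) \<Rightarrow> bool" where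
  "deterministic_markov X \<longleftrightarrow>
     (\<forall>x. X x 0 = x) \<and>
     (\<forall>x y. \<forall>s\<ge>0. \<forall>t\<ge>0. X x s = X y t \<longrightarrow> (\<forall>h\<ge>0. X x (s + h) = X y (t + h))) \<and>
     (\<forall>x. cadlag (X x))"

text \<open>
  The paths of a deterministic process do not depend on $\omega$, so the process started in $x$ is
  \<open>\<lambda>t \<omega>. X x t\<close> on whatever filtered probability space one works with.
\<close>

definition deterministic_hunt ::
  "'w measure \<Rightarrow> (ennreal \<Rightarrow> 'w measure) \<Rightarrow> ('a::topological_space \<Rightarrow> real \<Rightarrow> 'a) \<Rightarrow> bool" where
  "deterministic_hunt M F X \<longleftrightarrow>
     deterministic_markov X \<and> (\<forall>x. quasi_left_continuous M F (\<lambda>t \<omega>. X x t))"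

definition markov_expandable :: "(real \<Rightarrow> 'a::topological_space) \<Rightarrow> bool" where
  "markov_expandable f \<longleftrightarrow>
     (\<exists>X. deterministic_markov X \<and> (\<forall>t\<ge>0. X (f 0) t = f t))"

definition hunt_expandable ::
  "'w measure \<Rightarrow> (ennreal \<Rightarrow> 'w measure) \<Rightarrow> (real \<Rightarrow> 'a::topological_space) \<Rightarrow> bool" where
  "hunt_expandable M F f \<longleftrightarrow>
     (\<exists>X. deterministic_hunt M F X \<and> (\<forall>t\<ge>0. X (f 0) t = f t))"

end

theory Submission
  imports Defs
begin

text \<open>
  Constant times are stopping times, so quasi-left continuity forces a path with left limits to be
  left continuous. Conversely, the Markov property of an expansion of \<open>f\<close> makes the future of \<open>f\<close>
  a function of its current value; letting \<open>f\<close> run on its range and freezing every other point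
  gives an expansion whose paths are as continuous as \<open>f\<close> itself.
\<close>

lemma continuous_imp_cadlag:
  assumes "continuous_on {0..} f"
  shows "cadlag f"
proof -
  have at_within: "(f \<longlongrightarrow> f t) (at t within {0..})" if "t \<ge> 0" for t
    using assms that by (auto simp: continuous_on_def)
  have "(f \<longlongrightarrow> f t) (at_right t)" if "t \<ge> 0" for t
    by (rule tendsto_within_subset[OF at_within[OF that]]) (use that in auto)
  moreover have "(f \<longlongrightarrow> f t) (at_left t)" if "t > 0" for t
  proof -
    have "at t within {0..} = at t"
      by (rule at_within_interior) (use that in auto)
    then show ?thesis
      using at_within[of t] that by (auto intro: filterlim_mono at_le)
  qed
  ultimately show ?thesis
    unfolding cadlag_def by blast
qed

lemma cadlag_left_continuous_imp_continuous:
  assumes "cadlag f" and left: "\<And>t. t > 0 \<Longrightarrow> (f \<longlongrightarrow> f t) (at_left t)"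
  shows "continuous_on {0..} f"
  unfolding continuous_on_def
proof
  fix t :: real
  assume "t \<in> {0..}"
  then have "t \<ge> 0" by simp
  then have right: "(f \<longlongrightarrow> f t) (at_right t)"
    using assms(1) by (simp add: cadlag_def)
  \<comment> \<open>At 0 the filter within \<open>{0..}\<close> is already the right-hand one; at
    positive times it is bounded by the two-sided filter, which splits into left and right.\<close>
  show "(f \<longlongrightarrow> f t) (at t within {0..})"
  proof (cases "t = 0")
    case True
    then show ?thesis
      using right by (simp add: at_within_Ici_at_right)
  next
    case False
    then have "(f \<longlongrightarrow> f t) (at t)"
      using right left[of t] \<open>t \<ge> 0\<close> by (simp add: filterlim_at_split)
    then show ?thesis
      by (rule filterlim_mono) (auto intro: at_le)
  qed
qed

text \<open>The left limit \<open>l\<close> exists because \<open>f\<close> is cadlag, so one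
  sequence increasing strictly to \<open>t\<close> suffices to identify it with \<open>f t\<close>;
  limits are unique in a Hausdorff space.\<close>

lemma quasi_left_continuous_imp_left_continuous:
  fixes f :: "real \<Rightarrow> 'a::t2_space"
  assumes "filtered_prob_space M F" and "cadlag f"
    and "quasi_left_continuous M F (\<lambda>t \<omega>. f t)" and "t > 0"
  shows "(f \<longlongrightarrow> f t) (at_left t)"
proof -
  interpret filtered_prob_space M F by fact
  obtain l where l: "(f \<longlongrightarrow> l) (at_left t)"
    using assms(2,4) by (auto simp: cadlag_def)
  \<comment> \<open>The sequence starts at 0, so all times are nonnegative, and it stays strictly
    below \<open>t\<close>, so it converges along \<open>at_left t\<close>.\<close>
  define s where "s n = t - t / real (Suc n)" for n
  have s_ge: "s n \<ge> 0" and s_less: "s n < t" for n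
    using \<open>t > 0\<close> by (auto simp: s_def field_simps)
  have "incseq s"
    using \<open>t > 0\<close> by (auto simp: incseq_def s_def intro!: divide_left_mono)
  have s_lim: "s \<longlonglongrightarrow> t"
    unfolding s_def using tendsto_diff[OF tendsto_const[of t] LIMSEQ_Suc[OF lim_const_over_n[of t]]]
    by simp
  have inc: "incseq (\<lambda>n. ennreal (s n))"
    using \<open>incseq s\<close> by (auto simp: incseq_def intro!: ennreal_leI)
  have sup: "(SUP n. ennreal (s n)) = ennreal t"
    by (rule LIMSEQ_unique[OF LIMSEQ_SUP[OF inc]]) (intro tendsto_ennrealI s_lim)
  have "AE \<omega> in M. (\<lambda>n. f (s n)) \<longlonglongrightarrow> f t"
    using assms(3)[unfolded quasi_left_continuous_def, rule_format, of "\<lambda>n _. ennreal (s n)"]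
      inc sup s_ge \<open>t > 0\<close> by (simp add: stopping_time_const)
  \<comment> \<open>The statement does not depend on \<open>\<omega>\<close>, and a probability
    space is not null, so almost surely means outright.\<close>
  then have "(\<lambda>n. f (s n)) \<longlonglongrightarrow> f t"
    by simp
  moreover have "filterlim s (at_left t) sequentially"
    using s_lim s_less by (auto simp: filterlim_at less_imp_neq)
  then have "(\<lambda>n. f (s n)) \<longlonglongrightarrow> l"
    by (rule filterlim_compose[OF l])
  ultimately show ?thesis
    using l LIMSEQ_unique by blast
qed

lemma continuous_imp_quasi_left_continuous:
  fixes M :: "'w measure"
  assumes "continuous_on {0..} f"
  shows "quasi_left_continuous M F (\<lambda>t \<omega>. f t)"
  unfolding quasi_left_continuous_def
proof (intro allI impI AE_I2)
  fix T :: "nat \<Rightarrow> 'w \<Rightarrow> ennreal" and \<omega>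
  assume "\<forall>\<omega>\<in>space M. incseq (\<lambda>n. T n \<omega>)" and "\<omega> \<in> space M"
    and fin: "(SUP n. T n \<omega>) < \<infinity>"
  then have "(\<lambda>n. T n \<omega>) \<longlonglongrightarrow> (SUP n. T n \<omega>)"
    by (intro LIMSEQ_SUP) auto
  \<comment> \<open>Finiteness of the supremum matters: \<open>enn2real\<close> sends
    \<open>\<infinity>\<close> to 0 and is not continuous there.\<close>
  then have "(\<lambda>n. enn2real (T n \<omega>)) \<longlonglongrightarrow> enn2real (SUP n. T n \<omega>)"
    using fin by (intro tendsto_enn2real) (auto simp: less_top)
  then show "(\<lambda>n. f (enn2real (T n \<omega>))) \<longlonglongrightarrow> f (enn2real (SUP n. T n \<omega>))"
    by (rule continuous_on_tendsto_compose[OF assms]) auto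
qed

text \<open>The visiting time picked by \<open>SOME\<close> is arbitrary; the choice is immaterial
  once equal values of \<open>f\<close> have equal futures.\<close>

definition frozen_expansion :: "(real \<Rightarrow> 'a) \<Rightarrow> 'a \<Rightarrow> real \<Rightarrow> 'a" where
  "frozen_expansion f x t =
     (if x \<in> f ` {0..} then f ((SOME s. s \<ge> 0 \<and> f s = x) + t) else x)"

lemma frozen_expansion_cases:
  obtains (moving) s where "s \<ge> 0" "f s = x" "frozen_expansion f x = (\<lambda>t. f (s + t))"
  | (frozen) "x \<notin> f ` {0..}" "frozen_expansion f x = (\<lambda>t. x)"
proof (cases "x \<in> f ` {0..}")
  case True
  then have "\<exists>s. s \<ge> 0 \<and> f s = x" by auto
  then have "(SOME s. s \<ge> 0 \<and> f s = x) \<ge> 0 \<and> f (SOME s. s \<ge> 0 \<and> f s = x) = x"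
    by (rule someI_ex)
  with True show ?thesis
    by (intro that(1)[of "SOME s. s \<ge> 0 \<and> f s = x"]) (auto simp: frozen_expansion_def)
next
  case False
  then show ?thesis
    by (intro that(2)) (auto simp: frozen_expansion_def)
qed

lemma continuous_on_frozen_expansion:
  assumes "continuous_on {0..} f"
  shows "continuous_on {0..} (frozen_expansion f x)"
proof (cases rule: frozen_expansion_cases[of f x])
  case (moving s)
  then show ?thesis
    by (auto intro!: continuous_on_compose2[OF assms] continuous_intros)
qed simp

text \<open>Two moving paths are time shifts of \<open>f\<close>, so the hypothesis on
  \<open>f\<close> applies at the shifted times. A moving path stays in the range of
  \<open>f\<close> and a frozen one outside it, so they never meet. Two frozen paths that meet are
  equal.\<close>

lemma frozen_expansion_markov:
  assumes future: "\<And>s t h. \<lbrakk>s \<ge> 0; t \<ge> 0; h \<ge> 0; f s = f t\<rbrakk> \<Longrightarrow> f (s + h) = f (t + h)"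
    and "s \<ge> 0" "t \<ge> 0" "h \<ge> 0" and eq: "frozen_expansion f x s = frozen_expansion f y t"
  shows "frozen_expansion f x (s + h) = frozen_expansion f y (t + h)"
proof (cases rule: frozen_expansion_cases[of f x])
  case x: (moving a)
  show ?thesis
  proof (cases rule: frozen_expansion_cases[of f y])
    case y: (moving b)
    then show ?thesis
      using future[of "a + s" "b + t" h] x eq assms(2-4) by (simp add: add.assoc)
  next
    case frozen
    then show ?thesis
      using x eq assms(2) by (auto simp: image_iff)
  qed
next
  case x: frozen
  show ?thesis
  proof (cases rule: frozen_expansion_cases[of f y])
    case (moving b)
    then show ?thesis
      using x eq assms(3) by (auto simp: image_iff)
  qed (use x eq in simp)
qed

text \<open>The path from \<open>f 0\<close> is \<open>f\<close> itself, so the Markov property is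
  applied to this one starting point at two times.\<close>

lemma markov_expandable_future:
  assumes "markov_expandable f" and "s \<ge> 0" "t \<ge> 0" "h \<ge> 0" "f s = f t"
  shows "f (s + h) = f (t + h)"
proof -
  obtain X where X: "deterministic_markov X" and f: "\<And>t. t \<ge> 0 \<Longrightarrow> X (f 0) t = f t"
    using assms(1) by (auto simp: markov_expandable_def)
  have "X (f 0) s = X (f 0) t"
    using assms f by simp
  then have "X (f 0) (s + h) = X (f 0) (t + h)"
    using X assms(2-4) unfolding deterministic_markov_def by blast
  then show ?thesis
    using assms(2-4) by (simp add: f)
qed

theorem corollary2p7:
  fixes M :: "'w measure" and F :: "ennreal \<Rightarrow> 'w measure"
    and f :: "real \<Rightarrow> real ^ 'd"
  assumes "filtered_prob_space M F"
    and "cadlag f"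
  shows "hunt_expandable M F f \<longleftrightarrow> markov_expandable f \<and> continuous_on {0..} f"
proof (intro iffI conjI; (elim conjE)?)
  assume "hunt_expandable M F f"
  then obtain X where X: "deterministic_markov X" "\<And>x. quasi_left_continuous M F (\<lambda>t \<omega>. X x t)"
    and f: "\<And>t. t \<ge> 0 \<Longrightarrow> X (f 0) t = f t"
    by (auto simp: hunt_expandable_def deterministic_hunt_def)
  show "markov_expandable f"
    using X(1) f by (auto simp: markov_expandable_def)
  have cadlag: "cadlag (X (f 0))"
    using X(1) by (simp add: deterministic_markov_def)
  have "continuous_on {0..} (X (f 0))"
    using quasi_left_continuous_imp_left_continuous[OF assms(1) cadlag X(2)]
    by (rule cadlag_left_continuous_imp_continuous[OF cadlag])
  \<comment> \<open>The path and \<open>f\<close> agree only at nonnegative times, hence the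
    congruence on \<open>{0..}\<close>.\<close>
  then show "continuous_on {0..} f"
    using f by (subst (asm) continuous_on_cong[OF refl, of _ _ f]) auto
next
  assume markov: "markov_expandable f" and cont: "continuous_on {0..} f"
  let ?X = "frozen_expansion f"
  have start: "?X x 0 = x" for x
    by (rule frozen_expansion_cases[of f x]) auto
  have future: "\<And>s t h. \<lbrakk>s \<ge> 0; t \<ge> 0; h \<ge> 0; f s = f t\<rbrakk> \<Longrightarrow> f (s + h) = f (t + h)"
    by (rule markov_expandable_future[OF markov])
  have "deterministic_markov ?X"
    unfolding deterministic_markov_def
    using start frozen_expansion_markov[of f, OF future]
      continuous_imp_cadlag[OF continuous_on_frozen_expansion[OF cont]] by blast
  then have "deterministic_hunt M F ?X"
    using continuous_imp_quasi_left_continuous[OF continuous_on_frozen_expansion[OF cont]]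
    unfolding deterministic_hunt_def by blast
  moreover have "?X (f 0) t = f t" if "t \<ge> 0" for t
  proof (cases rule: frozen_expansion_cases[of f "f 0"])
    \<comment> \<open>The chosen \<open>s\<close> need not be 0 if \<open>f\<close> returns to
      \<open>f 0\<close>, but \<open>f s = f 0\<close> still gives
      \<open>f (s + t) = f t\<close>.\<close>
    case (moving s)
    then show ?thesis
      using future[of s 0 t] that by simp
  qed auto
  ultimately show "hunt_expandable M F f"
    unfolding hunt_expandable_def by blast
qed

end
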